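(* Let $c,\sigma\in\mathbb{R}$, let $N\in\{0,1,2,\dots\}\cup\{\infty\}$, let $\{x_j\}_{j=1}^N\subset\mathbb{R}\setminus\{0\}$ be a multiset with $\sum_{j=1}^N x_j^{-2}<\infty$, and let $$f(z)=e^{-cz-\frac{\sigma^2}{2}z^2}\prod_{j=1}^{N}\Big(1-\frac{z}{x_j}\Big)e^{z/x_j},\qquad G_f=\sigma^2\delta_0+\sum_{j=1}^N\frac{1}{x_j^2}\delta_{1/x_j}.$$ Let $\{p_d\}_{d=1}^\infty$ be a sequence of monic real rooted polynomials, $\deg p_d=d$, such that $m_1(p_d)\to c$, $m_2(p_d)=\Theta(d)$, and $$d\,t^2\,d\mu_{\mathcal{D}_{1/d}p_d}(t)\to dG_f(t)$$ weakly as Radon measures as $d\to\infty$. Then for every $\ell\in\mathbb{N}$, $$\lim_{d\to\infty}\frac{\ell!}{d!}D^{d-\ell}p_d(x)=f(D)x^\ell$$ uniformly on compact subsets, where $D=\frac{d}{dx}$.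
   Context: For a degree $d$ polynomial $p$ with real roots $y_1,\dots,y_d$ (with multiplicity), its empirical root measure is $\mu_p=\frac1d\sum_{j=1}^d\delta_{y_j}$ and its $k$-th moment is $m_k(p)=\frac1d\sum_{j=1}^d y_j^k$. For $\alpha>0$ the dilation of a degree $d$ polynomial is $\mathcal{D}_\alpha p(x)=\alpha^d p(x/\alpha)$, which multiplies the roots by $\alpha$. $a_d=\Theta(b_d)$ means there are constants $C>C'>0$ with $C'b_d<a_d<Cb_d$ for all large $d$. Weak convergence of finite measures on $\mathbb{R}$ means convergence of the integrals of bounded continuous functions. For a power series $f(z)=\sum_k f_kz^k$, $f(D)x^\ell=\sum_{k=0}^\ell f_k D^kx^\ell$. *)

theory Defs
  imports
    "HOL-Probability.Probability"
    "HOL-Complex_Analysis.Complex_Analysis"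
    "HOL-Computational_Algebra.Computational_Algebra"
begin

abbreviation complexify :: "real poly \<Rightarrow> complex poly" where
  "complexify \<equiv> map_poly complex_of_real"

definition real_rooted :: "real poly \<Rightarrow> bool" where
  "real_rooted p \<longleftrightarrow> p \<noteq> 0 \<and> (\<forall>z. poly (complexify p) z = 0 \<longrightarrow> z \<in> \<real>)"

text \<open>
  The Borel measure \<open>\<Sum>i\<in>I. w i * \<delta>(y i)\<close> with nonnegative weights; atoms may coincide.
\<close>
definition atomic_measure :: "'i set \<Rightarrow> ('i \<Rightarrow> real) \<Rightarrow> ('i \<Rightarrow> real) \<Rightarrow> real measure" where
  "atomic_measure I w y = distr (density (count_space I) (\<lambda>i. ennreal (w i))) borel y"

lemma emeasure_atomic_measure:
  assumes "A \<in> sets borel"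
  shows "emeasure (atomic_measure I w y) A =
           (\<integral>\<^sup>+ i. ennreal (w i) * indicator A (y i) \<partial>count_space I)"
proof -
  have "emeasure (atomic_measure I w y) A =
          emeasure (density (count_space I) (\<lambda>i. ennreal (w i))) (y -` A \<inter> I)"
    unfolding atomic_measure_def using assms by (subst emeasure_distr) auto
  also have "\<dots> = (\<integral>\<^sup>+ i. ennreal (w i) * indicator (y -` A \<inter> I) i \<partial>count_space I)"
    by (subst emeasure_density) auto
  also have "\<dots> = (\<integral>\<^sup>+ i. ennreal (w i) * indicator A (y i) \<partial>count_space I)"
    by (intro nn_integral_cong) (auto split: split_indicator)
  finally show ?thesis .
qed

definition root_measure :: "real poly \<Rightarrow> real measure" where
  "root_measure p =
     atomic_measure {y. poly p y = 0} (\<lambda>y. real (order y p) / real (degree p)) (\<lambda>y. y)"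

text \<open>\<open>proots p\<close> lists all roots of \<open>p\<close> with multiplicity when \<open>p\<close> is real rooted.\<close>
definition root_moment :: "nat \<Rightarrow> real poly \<Rightarrow> real" where
  "root_moment k p = (\<Sum>y\<in>#proots p. y ^ k) / real (degree p)"

text \<open>The polynomial \<open>\<alpha>^d * p (x / \<alpha>)\<close> with \<open>d = degree p\<close>.\<close>
definition dilation :: "real \<Rightarrow> real poly \<Rightarrow> real poly" where
  "dilation \<alpha> p = smult (\<alpha> ^ degree p) (pcompose p [:0, 1 / \<alpha>:])"

definition weakly_converges :: "(nat \<Rightarrow> real measure) \<Rightarrow> real measure \<Rightarrow> bool" where
  "weakly_converges M \<mu> \<longleftrightarrow>
     (\<forall>g :: real \<Rightarrow> real. continuous_on UNIV g \<longrightarrow> bounded (range g) \<longrightarrow>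
        (\<lambda>d. integral\<^sup>L (M d) g) \<longlonglongrightarrow> integral\<^sup>L \<mu> g)"

text \<open>
  A multiset \<open>{x_j}\<close> of cardinality \<open>N \<le> \<infinity>\<close> is given as a family \<open>x\<close> of which only the entries
  \<open>x j\<close> with \<open>j < N\<close> matter. All remaining factors of the infinite product are \<open>1\<close>.
\<close>
definition LP_function :: "real \<Rightarrow> real \<Rightarrow> enat \<Rightarrow> (nat \<Rightarrow> real) \<Rightarrow> complex \<Rightarrow> complex" where
  "LP_function c \<sigma> N x z =
     exp (- of_real c * z - of_real (\<sigma>\<^sup>2 / 2) * z\<^sup>2) *
     (\<Prod>j. if enat j < N then (1 - z / of_real (x j)) * exp (z / of_real (x j)) else 1)"

text \<open>\<open>G_f = \<sigma>\<^sup>2 \<delta>(0) + \<Sum>j<N. (1 / x j\<^sup>2) \<delta>(1 / x j)\<close>; the index \<open>None\<close> carries the atom at \<open>0\<close>.\<close>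
definition LP_measure :: "real \<Rightarrow> enat \<Rightarrow> (nat \<Rightarrow> real) \<Rightarrow> real measure" where
  "LP_measure \<sigma> N x =
     atomic_measure (insert None (Some ` {j. enat j < N}))
       (\<lambda>i. case i of None \<Rightarrow> \<sigma>\<^sup>2 | Some j \<Rightarrow> 1 / (x j)\<^sup>2)
       (\<lambda>i. case i of None \<Rightarrow> 0 | Some j \<Rightarrow> 1 / x j)"

text \<open>\<open>F(D) x^l\<close> for a power series \<open>F\<close>\<close>
definition fps_D_monom :: "complex fps \<Rightarrow> nat \<Rightarrow> complex poly" where
  "fps_D_monom F l = (\<Sum>k\<le>l. smult (fps_nth F k) ((pderiv ^^ k) (monom 1 l)))"

end

theory Submission
  imports Defs "HOL-Real_Asymp.Real_Asymp"
begin

text \<open>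
  For \<open>d \<ge> 1\<close> both sides are polynomials of degree at most \<open>l\<close>, so uniform convergence on compact
  sets follows from convergence of finitely many coefficients. Write \<open>u\<close> for the scaled roots \<open>y / d\<close>
  of \<open>p d\<close>. For \<open>d \<ge> l\<close>, the coefficient of degree \<open>l - k\<close> on the left is \<open>l! / (l - k)!\<close> times the \<open>k\<close>-th power series
  coefficient of \<open>\<Prod>u. (1 - u z)\<close>, times \<open>d ^ k (d - k)! / d!\<close>, which tends to \<open>1\<close>. On
  the right, \<open>l! / (l - k)!\<close> multiplies the \<open>k\<close>-th Taylor coefficient of \<open>f\<close>. What has to be shown is
  therefore that the Taylor coefficients at \<open>0\<close> of \<open>\<Prod>u. (1 - u z)\<close> converge to those of \<open>f\<close>.

  Newton's identities reduce this to power sums. If \<open>F 0 = 1\<close> and \<open>F' / F = - (\<Sum>k. S (k + 1) z ^ k)\<close>,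
  then each coefficient of \<open>F\<close> is a fixed polynomial expression in \<open>S 1, S 2, \<dots>\<close>
  (\<open>fps_nth_eq_newton\<close>), hence depends continuously on them (\<open>newton_tendsto\<close>). For
  \<open>\<Prod>u. (1 - u z)\<close> the numbers \<open>S k\<close> are the power sums of the \<open>u\<close>. For \<open>f\<close> they are \<open>c\<close> when
  \<open>k = 1\<close>, then \<open>\<sigma>\<^sup>2 + \<Sum>j. 1 / (x j)\<^sup>2\<close> when \<open>k = 2\<close>, and \<open>\<Sum>j. 1 / x j ^ k\<close> for larger \<open>k\<close>
  (\<open>fps_nth_LP_function\<close>); the partial products of \<open>f\<close> show this, since near \<open>0\<close> they converge
  uniformly to \<open>f\<close>.

  The power sums converge (\<open>scaled_power_sums_tendsto\<close>): the first one is the first moment of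
  \<open>p d\<close>, and for \<open>k \<ge> 2\<close> the \<open>k\<close>-th one is the integral of \<open>t ^ (k - 2)\<close> against the measure
  \<open>\<Sum>u. u\<^sup>2 \<delta>(u)\<close>, whose weak limit \<open>G_f\<close> gives the stated value. For \<open>k > 2\<close> the function
  \<open>t ^ (k - 2)\<close> is unbounded, but the total masses \<open>\<Sum>u. u\<^sup>2\<close> converge, so all the scaled roots lie in one compact
  interval and \<open>t\<close> may be truncated outside of it.
\<close>

section \<open>Power sums determine the coefficients of a product\<close>

text \<open>
  The logarithmic derivative as a generating function of power sums: for \<open>F = \<Prod>y. (1 - y z)\<close>, the
  number \<open>S k\<close> is the sum of the \<open>y ^ k\<close>. The same relation assigns numbers \<open>S k\<close> to an entire
  function with exponential factors.
\<close>
definition has_power_sums :: "'a::field fps \<Rightarrow> (nat \<Rightarrow> 'a) \<Rightarrow> bool" where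
  "has_power_sums F S \<longleftrightarrow>
     fps_nth F 0 = 1 \<and> fps_deriv F = - F * Abs_fps (\<lambda>k. S (Suc k))"

text \<open>
  The signed elementary symmetric functions \<open>(-1) ^ n * e n\<close> in terms of the power sums, by
  Newton's identities.
\<close>
fun newton :: "(nat \<Rightarrow> 'a::field) \<Rightarrow> nat \<Rightarrow> 'a" where
  "newton S 0 = 1"
| "newton S (Suc n) = - (\<Sum>i\<le>n. newton S (n - i) * S (Suc i)) / of_nat (Suc n)"

text \<open>
  Comparing the coefficients of \<open>z ^ n\<close> in \<open>F' = - F * (\<Sum>k. S (k + 1) z ^ k)\<close> gives the recursion
  that defines \<open>newton\<close>.
\<close>
lemma fps_nth_eq_newton:
  fixes F :: "'a::field_char_0 fps"
  assumes "has_power_sums F S"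
  shows "fps_nth F n = newton S n"
proof (induction n rule: less_induct)
  case (less n)
  show ?case
  proof (cases n)
    case 0
    then show ?thesis using assms by (simp add: has_power_sums_def)
  next
    case (Suc m)
    have "of_nat (Suc m) * fps_nth F (Suc m) = fps_nth (fps_deriv F) m"
      by (simp add: fps_deriv_def)
    also have "\<dots> = - fps_nth (Abs_fps (\<lambda>k. S (Suc k)) * F) m"
      using assms by (simp add: has_power_sums_def mult.commute[of F])
    also have "\<dots> = - (\<Sum>i\<le>m. newton S (m - i) * S (Suc i))"
      unfolding fps_mult_nth atLeast0AtMost
      using less Suc by (auto simp: mult.commute intro!: sum.cong)
    finally have "of_nat (Suc m) * fps_nth F (Suc m) = - (\<Sum>i\<le>m. newton S (m - i) * S (Suc i))" .
    moreover have "(of_nat (Suc m) :: 'a) \<noteq> 0"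
      by (rule of_nat_neq_0)
    ultimately show ?thesis
      unfolding Suc newton.simps by (metis nonzero_mult_div_cancel_left)
  qed
qed

lemma newton_tendsto:
  fixes S :: "nat \<Rightarrow> nat \<Rightarrow> 'a::real_normed_field"
  assumes "\<And>k. k \<ge> 1 \<Longrightarrow> (\<lambda>d. S d k) \<longlonglongrightarrow> L k"
  shows "(\<lambda>d. newton (S d) n) \<longlonglongrightarrow> newton L n"
proof (induction n rule: less_induct)
  case (less n)
  show ?case
  proof (cases n)
    case (Suc m)
    show ?thesis
      unfolding Suc newton.simps
      by (intro tendsto_divide tendsto_minus tendsto_sum tendsto_mult tendsto_const assms less)
         (auto simp: Suc simp del: of_nat_Suc)
  qed auto
qed

text \<open>\<open>newton S n\<close> is homogeneous of weight \<open>n\<close> when \<open>S k\<close> has weight \<open>k\<close>; this absorbs the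
  dilation of the roots.\<close>
lemma newton_scale:
  fixes S :: "nat \<Rightarrow> 'a::field"
  shows "newton (\<lambda>k. r ^ k * S k) n = r ^ n * newton S n"
proof (induction n rule: less_induct)
  case (less n)
  show ?case
  proof (cases n)
    case (Suc m)
    have "(\<Sum>i\<le>m. newton (\<lambda>k. r ^ k * S k) (m - i) * (r ^ Suc i * S (Suc i))) =
          (\<Sum>i\<le>m. r ^ Suc m * (newton S (m - i) * S (Suc i)))"
    proof (intro sum.cong refl)
      fix i assume i: "i \<in> {..m}"
      hence "r ^ Suc m = r ^ (m - i) * r ^ Suc i"
        by (simp add: power_add[symmetric] del: power_Suc)
      thus "newton (\<lambda>k. r ^ k * S k) (m - i) * (r ^ Suc i * S (Suc i)) =
              r ^ Suc m * (newton S (m - i) * S (Suc i))"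
        using less[of "m - i"] Suc by (simp add: mult_ac del: power_Suc)
    qed
    thus ?thesis
      unfolding Suc newton.simps by (simp add: sum_distrib_left)
  qed auto
qed

lemma newton_of_real:
  "newton (\<lambda>k. of_real (S k)) n = (of_real (newton S n) :: 'a::real_normed_field)"
proof (induction n rule: less_induct)
  case (less n)
  show ?case
  proof (cases n)
    case (Suc m)
    have "(\<Sum>i\<le>m. newton (\<lambda>k. of_real (S k)) (m - i) * (of_real (S (Suc i)) :: 'a)) =
          (\<Sum>i\<le>m. of_real (newton S (m - i) * S (Suc i)))"
      using less Suc by (intro sum.cong) auto
    thus ?thesis
      unfolding Suc newton.simps by simp
  qed auto
qed

lemma has_power_sums_cong:
  assumes "has_power_sums F S" "\<And>k. k \<ge> 1 \<Longrightarrow> S k = T k"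
  shows "has_power_sums F T"
  using assms by (simp add: has_power_sums_def)

lemma has_power_sums_1: "has_power_sums 1 (\<lambda>_. 0)"
  by (simp add: has_power_sums_def fps_eq_iff fps_mult_nth)

text \<open>Logarithmic derivatives of products add up.\<close>
lemma has_power_sums_mult:
  assumes "has_power_sums F S" "has_power_sums G T"
  shows "has_power_sums (F * G) (\<lambda>k. S k + T k)"
proof -
  have "Abs_fps (\<lambda>k. S (Suc k) + T (Suc k)) = Abs_fps (\<lambda>k. S (Suc k)) + Abs_fps (\<lambda>k. T (Suc k))"
    by (simp add: fps_eq_iff)
  thus ?thesis
    using assms by (simp add: has_power_sums_def algebra_simps)
qed

lemma has_power_sums_prod:
  assumes "\<And>j. j \<in> A \<Longrightarrow> has_power_sums (F j) (S j)"
  shows "has_power_sums (\<Prod>j\<in>A. F j) (\<lambda>k. \<Sum>j\<in>A. S j k)"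
  using assms
  by (induction A rule: infinite_finite_induct) (auto intro: has_power_sums_1 has_power_sums_mult)

lemma has_power_sums_prod_mset:
  assumes "\<And>y. y \<in># A \<Longrightarrow> has_power_sums (F y) (S y)"
  shows "has_power_sums (\<Prod>y\<in>#A. F y) (\<lambda>k. \<Sum>y\<in>#A. S y k)"
  using assms by (induction A) (auto intro: has_power_sums_1 has_power_sums_mult)

text \<open>The geometric series \<open>y / (1 - y z) = \<Sum>k. y ^ (k + 1) z ^ k\<close>, multiplied out.\<close>
lemma has_power_sums_linear:
  "has_power_sums (1 - fps_const y * fps_X) (\<lambda>k. y ^ k)"
  unfolding has_power_sums_def
proof (intro conjI fps_ext)
  fix n
  show "fps_nth (fps_deriv (1 - fps_const y * fps_X)) n =
        fps_nth (- (1 - fps_const y * fps_X) * Abs_fps (\<lambda>k. y ^ Suc k)) n"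
    by (cases n) (auto simp: algebra_simps)
qed auto

text \<open>The logarithmic derivative of \<open>exp Q\<close> is \<open>Q'\<close>. So the factor \<open>exp (w z)\<close> changes only the first
  power sum, and the Gaussian factor of \<open>f\<close> only the first two.\<close>
lemma has_power_sums_exp_compose:
  fixes Q :: "'a::field_char_0 fps"
  assumes "fps_nth Q 0 = 0"
  shows "has_power_sums (fps_exp 1 oo Q) (\<lambda>k. - of_nat k * fps_nth Q k)"
proof -
  have "fps_deriv (fps_exp 1 oo Q) = (fps_exp 1 oo Q) * fps_deriv Q"
    using assms by (simp add: fps_compose_deriv)
  moreover have "Abs_fps (\<lambda>k. - of_nat (Suc k) * fps_nth Q (Suc k)) = - fps_deriv Q"
    by (simp add: fps_eq_iff fps_deriv_def algebra_simps)
  ultimately show ?thesis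
    unfolding has_power_sums_def by (simp del: of_nat_Suc)
qed

section \<open>Real-rooted polynomials and their root measures\<close>

lemma complexify_mult: "complexify (p * q) = complexify p * complexify q"
  by (rule poly_eqI) (simp add: coeff_map_poly coeff_mult)

lemma poly_complexify_of_real: "poly (complexify p) (of_real y) = of_real (poly p y)"
  by (induction p) (auto simp: map_poly_pCons)

text \<open>The fundamental theorem of algebra gives a complex root, which real-rootedness makes real; it
  is split off and the degree drops.\<close>
lemma real_rooted_factorization:
  assumes "real_rooted p"
  shows "p = smult (lead_coeff p) (\<Prod>y\<in>#proots p. [:-y, 1:])"
  using assms
proof (induction "degree p" arbitrary: p rule: less_induct)
  case (less p)
  have p0: "p \<noteq> 0" using less.prems by (simp add: real_rooted_def)
  show ?case
  proof (cases "degree p = 0")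
    case True
    then obtain a where "p = [:a:]" by (auto elim: degree_eq_zeroE)
    thus ?thesis by simp
  next
    case False
    hence "\<not> constant (poly (complexify p))"
      by (simp add: constant_degree degree_map_poly)
    then obtain z where z: "poly (complexify p) z = 0"
      using fundamental_theorem_of_algebra by blast
    with less.prems obtain y where "z = complex_of_real y"
      by (auto simp: real_rooted_def elim!: Reals_cases)
    with z have "poly p y = 0" by (simp add: poly_complexify_of_real)
    then obtain q where q: "p = [:-y, 1:] * q"
      by (auto simp: poly_eq_0_iff_dvd)
    with p0 have q0: "q \<noteq> 0" by auto
    have "complexify p = complexify [:-y, 1:] * complexify q"
      unfolding q by (rule complexify_mult)
    hence "real_rooted q"
      using less.prems q0 by (auto simp: real_rooted_def)
    moreover have "degree q < degree p"
      using q0 by (simp add: q degree_mult_eq del: mult_pCons_left)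
    ultimately have "q = smult (lead_coeff q) (\<Prod>y\<in>#proots q. [:-y, 1:])"
      using less.hyps by blast
    moreover have "proots p = add_mset y (proots q)"
      using q0 by (simp add: q proots_mult del: mult_pCons_left)
    moreover have "lead_coeff p = lead_coeff q"
      by (simp add: q lead_coeff_mult del: mult_pCons_left)
    ultimately show ?thesis
      using q by (simp del: mult_pCons_left) (metis mult_smult_right)
  qed
qed

text \<open>Reversing the coefficients turns \<open>\<Prod>y. (z - y)\<close> into \<open>\<Prod>y. (1 - y z)\<close>, whose power sums are those of
  the roots.\<close>
lemma coeff_real_rooted_eq_newton:
  assumes "real_rooted p" "lead_coeff p = 1" "k \<le> degree p"
  shows "coeff p (degree p - k) = newton (\<lambda>i. \<Sum>y\<in>#proots p. y ^ i) k"
proof -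
  have *: "reflect_poly (\<Prod>y\<in>#A. [:-y, 1:]) = (\<Prod>y\<in>#A. [:1, -y:])" for A :: "real multiset"
  proof (induction A)
    case (add y A)
    have "reflect_poly [:-y, 1:] = [:1, -y:]"
      by (cases "y = 0") (auto simp: reflect_poly_pCons reflect_poly_pCons')
    with add show ?case by (simp add: reflect_poly_mult del: mult_pCons_left)
  qed auto
  have **: "fps_of_poly (\<Prod>y\<in>#A. [:1, -y:]) = (\<Prod>y\<in>#A. 1 - fps_const y * fps_X)"
    for A :: "real multiset"
    by (induction A) (auto simp: fps_of_poly_mult fps_of_poly_linear' simp del: mult_pCons_left
                           simp flip: fps_const_neg)
  have p: "p = (\<Prod>y\<in>#proots p. [:-y, 1:])"
    using real_rooted_factorization[OF assms(1)] assms(2) by simp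
  have "coeff p (degree p - k) = coeff (reflect_poly p) k"
    using assms(3) by (simp add: coeff_reflect_poly)
  also have "reflect_poly p = (\<Prod>y\<in>#proots p. [:1, -y:])"
    by (subst p) (rule *)
  also have "coeff \<dots> k = fps_nth (\<Prod>y\<in>#proots p. 1 - fps_const y * fps_X) k"
    by (simp flip: **)
  also have "\<dots> = newton (\<lambda>i. \<Sum>y\<in>#proots p. y ^ i) k"
    by (intro fps_nth_eq_newton has_power_sums_prod_mset has_power_sums_linear)
  finally show ?thesis .
qed

lemma proots_dilation:
  assumes "real_rooted p" "\<alpha> \<noteq> 0"
  shows "proots (dilation \<alpha> p) = image_mset (\<lambda>y. \<alpha> * y) (proots p)"
proof -
  have p0: "p \<noteq> 0" using assms(1) by (simp add: real_rooted_def)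
  have lin: "[:-y, 1:] \<circ>\<^sub>p [:0, 1 / \<alpha>:] = smult (1 / \<alpha>) [:-(\<alpha> * y), 1:]" for y
    using assms(2) by (simp add: pcompose_pCons)
  have *: "proots ((\<Prod>y\<in>#A. [:-y, 1:]) \<circ>\<^sub>p [:0, 1 / \<alpha>:]) = image_mset (\<lambda>y. \<alpha> * y) A \<and>
           (\<Prod>y\<in>#A. [:-y, 1:]) \<circ>\<^sub>p [:0, 1 / \<alpha>:] \<noteq> 0" for A
  proof (induction A)
    case (add y A)
    have "(\<Prod>y\<in>#add_mset y A. [:-y, 1:]) \<circ>\<^sub>p [:0, 1 / \<alpha>:] =
          smult (1 / \<alpha>) [:-(\<alpha> * y), 1:] * ((\<Prod>y\<in>#A. [:-y, 1:]) \<circ>\<^sub>p [:0, 1 / \<alpha>:])"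
      unfolding image_mset_add_mset prod_mset.add_mset pcompose_mult lin ..
    moreover have "smult (1 / \<alpha>) [:-(\<alpha> * y), 1:] \<noteq> 0"
      using assms(2) by simp
    moreover have "proots (smult (1 / \<alpha>) [:-(\<alpha> * y), 1:]) = {#\<alpha> * y#}"
      using assms(2) by (subst proots_smult) auto
    ultimately show ?case
      using add by (simp add: proots_mult del: smult_pCons mult_pCons_left)
  qed (auto simp: one_pCons pcompose_pCons)
  have "dilation \<alpha> p = smult (\<alpha> ^ degree p * lead_coeff p)
          ((\<Prod>y\<in>#proots p. [:-y, 1:]) \<circ>\<^sub>p [:0, 1 / \<alpha>:])"
    unfolding dilation_def
    by (subst (2) real_rooted_factorization[OF assms(1)]) (simp add: pcompose_smult)
  thus ?thesis
    using assms(2) p0 * by simp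
qed

lemma integral_atomic_measure:
  fixes g :: "real \<Rightarrow> real"
  assumes "g \<in> borel_measurable borel" "\<And>i. i \<in> I \<Longrightarrow> 0 \<le> w i"
  shows "integral\<^sup>L (atomic_measure I w y) g = (\<integral>i. w i * g (y i) \<partial>count_space I)"
  unfolding atomic_measure_def using assms
  by (subst integral_distr) (auto simp: integral_density AE_count_space)

lemma sum_mset_eq_sum_count:
  fixes f :: "'b \<Rightarrow> real"
  shows "(\<Sum>y\<in>#A. f y) = (\<Sum>y\<in>set_mset A. real (count A y) * f y)"
proof (induction A)
  case (add a A)
  have "(\<Sum>y\<in>set_mset (add_mset a A). real (count (add_mset a A) y) * f y) =
        (\<Sum>y\<in>insert a (set_mset A). real (count A y) * f y + (if y = a then f a else 0))"
    by (intro sum.cong) (auto simp: algebra_simps)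
  also have "\<dots> = (\<Sum>y\<in>insert a (set_mset A). real (count A y) * f y) + f a"
    by (simp add: sum.distrib)
  also have "(\<Sum>y\<in>insert a (set_mset A). real (count A y) * f y) =
             (\<Sum>y\<in>set_mset A. real (count A y) * f y)"
    by (intro sum.mono_neutral_right) (auto simp: not_in_iff)
  finally show ?case using add by simp
qed auto

lemma integral_root_measure:
  fixes g :: "real \<Rightarrow> real"
  assumes "g \<in> borel_measurable borel" "q \<noteq> 0"
  shows "integral\<^sup>L (root_measure q) g = (\<Sum>y\<in>#proots q. g y) / real (degree q)"
  using assms poly_roots_finite[of q]
  by (simp add: root_measure_def integral_atomic_measure lebesgue_integral_count_space_finite
                sum_mset_eq_sum_count sum_divide_distrib)

text \<open>The normalisation \<open>1 / d\<close> of the root measure cancels against the density \<open>d * t\<^sup>2\<close>, which leaves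
  \<open>u\<^sup>2\<close> as the mass of a scaled root \<open>u\<close>.\<close>
lemma integral_scaled_root_measure:
  fixes g :: "real \<Rightarrow> real"
  assumes "real_rooted p" "degree p = d" "d > 0" and [measurable]: "g \<in> borel_measurable borel"
  shows "integral\<^sup>L (density (root_measure (dilation (1 / real d) p))
             (\<lambda>t. ennreal (real d * t\<^sup>2))) g =
         (\<Sum>y\<in>#proots p. (y / real d)\<^sup>2 * g (y / real d))"
proof -
  let ?q = "dilation (1 / real d) p"
  have p0: "p \<noteq> 0" using assms(1) by (simp add: real_rooted_def)
  have deg: "degree ?q = d"
    using assms p0 by (simp add: dilation_def degree_pcompose)
  hence q0: "?q \<noteq> 0" using assms(3) by auto
  have [measurable_cong]: "sets (root_measure ?q) = sets borel"
    by (simp add: root_measure_def atomic_measure_def)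
  have "integral\<^sup>L (density (root_measure ?q) (\<lambda>t. ennreal (real d * t\<^sup>2))) g =
        integral\<^sup>L (root_measure ?q) (\<lambda>t. real d * t\<^sup>2 * g t)"
    by (subst integral_density) auto
  also have "\<dots> = (\<Sum>y\<in>#proots ?q. real d * y\<^sup>2 * g y) / real d"
    using q0 deg by (subst integral_root_measure) auto
  also have "\<dots> = (\<Sum>y\<in>#proots ?q. y\<^sup>2 * g y)"
    using assms(3) by (simp add: sum_mset_distrib_left[symmetric] mult.assoc)
  also have "\<dots> = (\<Sum>y\<in>#proots p. (y / real d)\<^sup>2 * g (y / real d))"
    using assms by (subst proots_dilation) (auto simp: image_mset.compositionality o_def)
  finally show ?thesis .
qed

section \<open>The limit measure\<close>

text \<open>
  The reciprocals \<open>1 / x j\<close>, padded with \<open>0\<close>: an atom at \<open>0\<close> of weight \<open>0\<^sup>2\<close> adds nothing to the limit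
  measure, and the factor \<open>(1 - 0 * z) * exp (0 * z)\<close> nothing to the product. All cases of \<open>N\<close> thus
  become series and products over the natural numbers.
\<close>
definition atoms :: "enat \<Rightarrow> (nat \<Rightarrow> real) \<Rightarrow> nat \<Rightarrow> real" where
  "atoms N x j = (if enat j < N then 1 / x j else 0)"

text \<open>
  A bounded \<open>g\<close> makes the integral an absolutely convergent sum over the index set of \<open>LP_measure\<close>;
  the index \<open>None\<close> is separated from the others.
\<close>
lemma integral_LP_measure_sums:
  fixes g :: "real \<Rightarrow> real"
  assumes summ: "(\<lambda>j. 1 / (x j)\<^sup>2) summable_on {j. enat j < N}"
    and g: "continuous_on UNIV g" "bounded (range g)"
  shows "(\<lambda>j. (atoms N x j)\<^sup>2 * g (atoms N x j)) sums
           (integral\<^sup>L (LP_measure \<sigma> N x) g - \<sigma>\<^sup>2 * g 0)"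
proof -
  define J where "J = {j. enat j < N}"
  define h :: "nat option \<Rightarrow> real" where
    "h = (\<lambda>i. (case i of None \<Rightarrow> \<sigma>\<^sup>2 | Some j \<Rightarrow> 1 / (x j)\<^sup>2) * g (case i of None \<Rightarrow> 0 | Some j \<Rightarrow> 1 / x j))"
  define f where "f = (\<lambda>j. 1 / (x j)\<^sup>2 * g (1 / x j))"
  obtain C where C: "\<And>t. \<bar>g t\<bar> \<le> C"
    using g(2) by (auto simp: bounded_iff)
  have "Infinite_Set_Sum.abs_summable_on (\<lambda>j. 1 / (x j)\<^sup>2) J"
    unfolding abs_summable_equivalent[symmetric] using summ by (simp add: J_def)
  hence "Infinite_Set_Sum.abs_summable_on (\<lambda>j. C * (1 / (x j)\<^sup>2)) J"
    by (intro abs_summable_on_cmult_right)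
  hence f: "Infinite_Set_Sum.abs_summable_on f J"
  proof (rule abs_summable_on_comparison_test)
    fix j
    have "\<bar>1 / (x j)\<^sup>2 * g (1 / x j)\<bar> \<le> 1 / (x j)\<^sup>2 * C"
      using C[of "1 / x j"] unfolding abs_mult by (intro mult_mono) auto
    also have "\<dots> \<le> \<bar>C * (1 / (x j)\<^sup>2)\<bar>"
      by (metis abs_ge_self mult.commute)
    finally show "norm (f j) \<le> norm (C * (1 / (x j)\<^sup>2))"
      unfolding f_def real_norm_def .
  qed
  have hf: "f = (\<lambda>j. h (Some j))"
    by (simp add: f_def h_def)
  have h: "Infinite_Set_Sum.abs_summable_on h (Some ` J)"
    using f unfolding hf by (subst abs_summable_on_reindex_iff[symmetric]) auto
  have "integral\<^sup>L (LP_measure \<sigma> N x) g = infsetsum h ({None} \<union> Some ` J)"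
    unfolding LP_measure_def infsetsum_def h_def J_def
    by (subst integral_atomic_measure)
       (auto intro!: borel_measurable_continuous_onI g split: option.splits)
  also have "\<dots> = infsetsum h {None} + infsetsum h (Some ` J)"
    using h by (intro infsetsum_Un_disjoint) auto
  also have "infsetsum h (Some ` J) = infsetsum f J"
    unfolding hf by (subst infsetsum_reindex) auto
  finally have "integral\<^sup>L (LP_measure \<sigma> N x) g - \<sigma>\<^sup>2 * g 0 = infsetsum f J"
    by (simp add: h_def)
  moreover have "(\<lambda>j. if j \<in> J then f j else 0) = (\<lambda>j. (atoms N x j)\<^sup>2 * g (atoms N x j))"
    by (auto simp: fun_eq_iff J_def f_def atoms_def power_one_over)
  ultimately show ?thesis
    using sums_infsetsum_nat[OF f] by simp
qed

text \<open>The limits of the power sums of the scaled roots, which turn out to be the power sums of \<open>f\<close>.\<close>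
definition LP_power_sum :: "real \<Rightarrow> real \<Rightarrow> enat \<Rightarrow> (nat \<Rightarrow> real) \<Rightarrow> nat \<Rightarrow> real" where
  "LP_power_sum c \<sigma> N x k =
     (if k = 1 then c else (if k = 2 then \<sigma>\<^sup>2 else 0) + (\<Sum>j. atoms N x j ^ k))"

text \<open>For \<open>\<sigma> = 0\<close> and \<open>g = 1\<close> the series above is the total mass of the limit measure.\<close>
lemma summable_atoms_square:
  assumes "(\<lambda>j. 1 / (x j)\<^sup>2) summable_on {j. enat j < N}"
  shows "summable (\<lambda>j. (atoms N x j)\<^sup>2)"
  using integral_LP_measure_sums[OF assms, of "\<lambda>_. 1" 0] by (auto dest: sums_summable)

lemma abs_atoms_le:
  assumes "(\<lambda>j. 1 / (x j)\<^sup>2) summable_on {j. enat j < N}"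
  obtains B where "\<And>j. \<bar>atoms N x j\<bar> \<le> B"
proof -
  have "(\<lambda>j. (atoms N x j)\<^sup>2) \<longlonglongrightarrow> 0"
    using summable_atoms_square[OF assms] by (rule summable_LIMSEQ_zero)
  hence "(\<lambda>j. sqrt ((atoms N x j)\<^sup>2)) \<longlonglongrightarrow> sqrt 0"
    by (rule tendsto_real_sqrt)
  hence "Bseq (\<lambda>j. \<bar>atoms N x j\<bar>)"
    by (intro convergent_imp_Bseq convergentI[of _ 0]) simp
  thus ?thesis
    using that by (auto simp: Bseq_def)
qed

text \<open>
  Here \<open>g\<close> stands for a bounded modification of \<open>t ^ m\<close>. With \<open>0 ^ 0 = 1\<close>, the atom \<open>\<sigma>\<^sup>2\<close> at the origin
  is seen exactly by \<open>m = 0\<close>, that is, by the second power sum.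
\<close>
lemma power_sum_eq_integral_LP_measure:
  fixes g :: "real \<Rightarrow> real"
  assumes summ: "(\<lambda>j. 1 / (x j)\<^sup>2) summable_on {j. enat j < N}"
    and g: "continuous_on UNIV g" "bounded (range g)"
    and g_eq: "g 0 = 0 ^ m" "\<And>j. g (atoms N x j) = atoms N x j ^ m"
  shows "integral\<^sup>L (LP_measure \<sigma> N x) g = LP_power_sum c \<sigma> N x (m + 2)"
    and "summable (\<lambda>j. atoms N x j ^ (m + 2))"
proof -
  have *: "(\<lambda>j. atoms N x j ^ (m + 2)) sums (integral\<^sup>L (LP_measure \<sigma> N x) g - \<sigma>\<^sup>2 * g 0)"
    using integral_LP_measure_sums[OF summ g, of \<sigma>]
    by (simp add: g_eq power_add power2_eq_square mult_ac)
  show "summable (\<lambda>j. atoms N x j ^ (m + 2))"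
    using * by (rule sums_summable)
  show "integral\<^sup>L (LP_measure \<sigma> N x) g = LP_power_sum c \<sigma> N x (m + 2)"
    using sums_unique[OF *] by (cases m) (auto simp: LP_power_sum_def g_eq)
qed

text \<open>The power function with its argument truncated to \<open>[- B, B]\<close>: a bounded continuous test
  function that agrees with \<open>t ^ m\<close> on this interval.\<close>
definition clamp_power :: "real \<Rightarrow> nat \<Rightarrow> real \<Rightarrow> real" where
  "clamp_power B m t = max (- B) (min B t) ^ m"

lemma clamp_power_eq: "\<bar>t\<bar> \<le> B \<Longrightarrow> clamp_power B m t = t ^ m"
proof -
  assume "\<bar>t\<bar> \<le> B"
  hence "max (- B) (min B t) = t" by auto
  thus ?thesis by (simp add: clamp_power_def)
qed

lemma continuous_clamp_power: "continuous_on UNIV (clamp_power B m)"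
  unfolding clamp_power_def by (intro continuous_intros)

lemma bounded_clamp_power: "bounded (range (clamp_power B m))"
proof (rule boundedI)
  fix s assume "s \<in> range (clamp_power B m)"
  then obtain t where s: "s = clamp_power B m t" by blast
  have "\<bar>max (- B) (min B t)\<bar> \<le> \<bar>B\<bar>" by auto
  thus "norm s \<le> \<bar>B\<bar> ^ m"
    by (simp add: s clamp_power_def power_abs power_mono)
qed

lemma summable_atoms_power:
  assumes summ: "(\<lambda>j. 1 / (x j)\<^sup>2) summable_on {j. enat j < N}" and "k \<ge> 2"
  shows "summable (\<lambda>j. atoms N x j ^ k)"
proof -
  obtain B where "\<And>j. \<bar>atoms N x j\<bar> \<le> B"
    using abs_atoms_le[OF summ] by blast
  moreover from this[of 0] have "B \<ge> 0" by simp
  ultimately have "summable (\<lambda>j. atoms N x j ^ (k - 2 + 2))"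
    using power_sum_eq_integral_LP_measure(2)[OF summ continuous_clamp_power bounded_clamp_power, of B "k - 2" "k - 2"]
    by (simp add: clamp_power_eq del: power_Suc power_add add_2_eq_Suc')
  thus ?thesis using assms(2) by (simp add: le_add_diff_inverse2 del: add_2_eq_Suc')
qed

section \<open>Convergence of the power sums\<close>

text \<open>
  For \<open>k \<ge> 2\<close> the power sum is the integral of \<open>t ^ (k - 2)\<close> against the weakly convergent measures.
  Their total masses \<open>\<Sum>u. u\<^sup>2\<close> are bounded by some \<open>C\<close>, so every scaled root has modulus at most
  \<open>sqrt C\<close>, and \<open>t ^ (k - 2)\<close> may be replaced by a bounded test function.
\<close>
lemma scaled_power_sums_tendsto:
  fixes p :: "nat \<Rightarrow> real poly"
  assumes x_summable: "(\<lambda>j. 1 / (x j)\<^sup>2) summable_on {j. enat j < N}"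
    and p_degree: "\<And>d. d \<ge> 1 \<Longrightarrow> degree (p d) = d"
    and p_real_rooted: "\<And>d. d \<ge> 1 \<Longrightarrow> real_rooted (p d)"
    and moment1: "(\<lambda>d. root_moment 1 (p d)) \<longlonglongrightarrow> c"
    and weak: "weakly_converges
        (\<lambda>d. density (root_measure (dilation (1 / real d) (p d))) (\<lambda>t. ennreal (real d * t\<^sup>2)))
        (LP_measure \<sigma> N x)"
    and "k \<ge> 1"
  shows "(\<lambda>d. \<Sum>y\<in>#proots (p d). (y / real d) ^ k) \<longlonglongrightarrow> LP_power_sum c \<sigma> N x k"
proof (cases "k = 1")
  case True
  have ev: "eventually (\<lambda>d. (\<Sum>y\<in>#proots (p d). (y / real d) ^ k) = root_moment 1 (p d)) sequentially"
    using eventually_ge_at_top[of 1]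
  proof eventually_elim
    case (elim d)
    have "(\<Sum>y\<in>#A. y / real d) = (\<Sum>y\<in>#A. y) / real d" for A
      by (induction A) (auto simp: add_divide_distrib)
    thus ?case
      using elim True p_degree by (simp add: root_moment_def)
  qed
  thus ?thesis
    using tendsto_cong[THEN iffD2, OF ev moment1] True by (simp add: LP_power_sum_def)
next
  case False
  define M where
    "M = (\<lambda>d. density (root_measure (dilation (1 / real d) (p d))) (\<lambda>t. ennreal (real d * t\<^sup>2)))"
  have int_M: "integral\<^sup>L (M d) g = (\<Sum>y\<in>#proots (p d). (y / real d)\<^sup>2 * g (y / real d))"
    if "d \<ge> 1" "continuous_on UNIV g" for d and g :: "real \<Rightarrow> real"
    unfolding M_def using that p_degree[of d] p_real_rooted[of d]
    by (intro integral_scaled_root_measure borel_measurable_continuous_onI) auto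
  have lim: "(\<lambda>d. integral\<^sup>L (M d) g) \<longlonglongrightarrow> integral\<^sup>L (LP_measure \<sigma> N x) g"
    if "continuous_on UNIV g" "bounded (range g)" for g :: "real \<Rightarrow> real"
    using weak[unfolded weakly_converges_def, rule_format, OF that] unfolding M_def .
  have "Bseq (\<lambda>d. integral\<^sup>L (M d) (\<lambda>_. 1::real))"
    by (rule convergent_imp_Bseq, rule convergentI, rule lim) simp_all
  then obtain C where C: "\<And>d. norm (integral\<^sup>L (M d) (\<lambda>_. 1::real)) \<le> C"
    unfolding Bseq_def by blast
  have root_bound: "\<bar>y / real d\<bar> \<le> sqrt C" if d: "d \<ge> 1" and y: "y \<in># proots (p d)" for d y
  proof -
    have "(y / real d)\<^sup>2 \<le> (\<Sum>y\<in>#proots (p d). (y / real d)\<^sup>2)"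
    proof -
      obtain A where "proots (p d) = add_mset y A"
        using y by (blast dest: multi_member_split)
      moreover have "(\<Sum>y\<in>#A. (y / real d)\<^sup>2) \<ge> 0"
        by (induction A) auto
      ultimately show ?thesis by simp
    qed
    also have "\<dots> \<le> C"
      using int_M[of d "\<lambda>_. 1"] d C[of d] by simp
    finally show ?thesis
      by (rule real_le_rsqrt[of "\<bar>_\<bar>", simplified])
  qed
  obtain B' where B': "\<And>j. \<bar>atoms N x j\<bar> \<le> B'"
    using abs_atoms_le[OF x_summable] by blast
  \<comment> \<open>one truncation level that affects neither the scaled roots nor the atoms of the limit\<close>
  define B where "B = max (sqrt C) B'"
  have "B \<ge> 0" using B'[of 0] unfolding B_def by linarith
  define g where "g = clamp_power B (k - 2)"
  have g: "continuous_on UNIV g" "bounded (range g)"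
    by (simp_all add: g_def continuous_clamp_power bounded_clamp_power)
  have "integral\<^sup>L (LP_measure \<sigma> N x) g = LP_power_sum c \<sigma> N x (k - 2 + 2)"
    using \<open>B \<ge> 0\<close> B'
    by (intro power_sum_eq_integral_LP_measure x_summable g) 
       (auto simp: g_def B_def le_max_iff_disj intro!: clamp_power_eq)
  moreover have ev: "eventually (\<lambda>d. integral\<^sup>L (M d) g = (\<Sum>y\<in>#proots (p d). (y / real d) ^ k)) sequentially"
    using eventually_ge_at_top[of 1]
  proof eventually_elim
    case (elim d)
    have "(y / real d)\<^sup>2 * g (y / real d) = (y / real d) ^ k" if "y \<in># proots (p d)" for y
    proof -
      have "g (y / real d) = (y / real d) ^ (k - 2)"
        unfolding g_def using root_bound[OF elim that]
        by (intro clamp_power_eq) (auto simp: B_def)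
      moreover have "2 + (k - 2) = k" using assms(6) False by simp
      ultimately show ?thesis by (metis power_add)
    qed
    thus ?case
      unfolding int_M[OF elim g(1)] by (intro arg_cong[of _ _ sum_mset] image_mset_cong) auto
  qed
  moreover have "k - 2 + 2 = k" using assms(6) False by simp
  ultimately show ?thesis
    using tendsto_cong[THEN iffD1, OF ev lim[OF g]] by simp
qed

section \<open>The limit function\<close>

lemma weierstrass_factor_1_eq: "weierstrass_factor 1 z = (1 - z) * exp z"
  by (simp add: weierstrass_factor_def)

definition LP_factor :: "enat \<Rightarrow> (nat \<Rightarrow> real) \<Rightarrow> nat \<Rightarrow> complex \<Rightarrow> complex" where
  "LP_factor N x j z = weierstrass_factor 1 (of_real (atoms N x j) * z)"

lemma LP_function_eq_prodinf:
  "LP_function c \<sigma> N x z =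
     exp (- of_real c * z - of_real (\<sigma>\<^sup>2 / 2) * z\<^sup>2) * (\<Prod>j. LP_factor N x j z)"
  unfolding LP_function_def LP_factor_def weierstrass_factor_1_eq atoms_def
  by (intro arg_cong2[of _ _ _ _ "(*)"] arg_cong[of _ _ prodinf]) (auto simp: fun_eq_iff)

text \<open>The factor \<open>(1 - w z) * exp (w z)\<close> has no linear term at \<open>0\<close>, so its distance to \<open>1\<close> is of order
  \<open>w\<^sup>2\<close>, which is summable. A fixed neighbourhood of \<open>0\<close> is enough for Taylor coefficients; the radius
  \<open>1\<close> works because \<open>w\<close> tends to \<open>0\<close>.\<close>
lemma norm_LP_factor_minus_1_le:
  assumes summ: "(\<lambda>j. 1 / (x j)\<^sup>2) summable_on {j. enat j < N}"
  shows "eventually (\<lambda>j. \<forall>z\<in>cball 0 1. norm (LP_factor N x j z - 1) \<le> 3 * (atoms N x j)\<^sup>2) sequentially"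
proof -
  have "(\<lambda>j. (atoms N x j)\<^sup>2) \<longlonglongrightarrow> 0"
    using summable_atoms_square[OF summ] by (rule summable_LIMSEQ_zero)
  hence "eventually (\<lambda>j. (atoms N x j)\<^sup>2 < (1/2)\<^sup>2) sequentially"
    by (rule order_tendstoD) auto
  thus ?thesis
  proof eventually_elim
    case (elim j)
    hence half: "\<bar>atoms N x j\<bar> \<le> 1 / 2"
      using power2_le_iff_abs_le[of "1/2" "atoms N x j"] by simp
    show ?case
    proof
      fix z :: complex assume "z \<in> cball 0 1"
      hence z: "norm z \<le> 1" by simp
      have le: "norm (of_real (atoms N x j) * z) \<le> \<bar>atoms N x j\<bar>"
        using mult_left_mono[OF z, of "\<bar>atoms N x j\<bar>"] by (simp add: norm_mult)
      hence "norm (LP_factor N x j z - 1) \<le> 3 * norm (of_real (atoms N x j) * z) ^ Suc 1"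
        unfolding LP_factor_def using half by (intro weierstrass_factor_bound) linarith
      also have "\<dots> \<le> 3 * \<bar>atoms N x j\<bar> ^ Suc 1"
        using le by (intro mult_left_mono power_mono) auto
      finally show "norm (LP_factor N x j z - 1) \<le> 3 * (atoms N x j)\<^sup>2"
        by (simp add: power2_eq_square)
    qed
  qed
qed

lemma uniform_limit_LP_factor_prod:
  assumes summ: "(\<lambda>j. 1 / (x j)\<^sup>2) summable_on {j. enat j < N}"
  shows "uniform_limit (cball 0 1) (\<lambda>n z. \<Prod>j<n. LP_factor N x j z)
           (\<lambda>z. \<Prod>j. LP_factor N x j z) sequentially"
proof -
  have sum3: "summable (\<lambda>j. 3 * (atoms N x j)\<^sup>2)"
    by (intro summable_mult summable_atoms_square summ)
  have "uniformly_convergent_on (cball 0 1) (\<lambda>n z. \<Prod>j<n. LP_factor N x j z)"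
  proof (rule uniformly_convergent_on_prod')
    show "uniformly_convergent_on (cball 0 1) (\<lambda>n z. \<Sum>j<n. norm (LP_factor N x j z - 1))"
      by (rule Weierstrass_m_test'_ev[OF _ sum3])
         (use norm_LP_factor_minus_1_le[OF summ] in simp)
  qed (auto simp: LP_factor_def intro!: continuous_intros)
  then obtain g where g: "uniform_limit (cball 0 1) (\<lambda>n z. \<Prod>j<n. LP_factor N x j z) g sequentially"
    by (auto simp: uniformly_convergent_on_def)
  have "g z = (\<Prod>j. LP_factor N x j z)" if z: "z \<in> cball 0 1" for z
  proof -
    have "summable (\<lambda>j. norm (LP_factor N x j z - 1))"
      by (rule summable_comparison_test_ev[OF _ sum3])
         (use norm_LP_factor_minus_1_le[OF summ] z in \<open>auto elim!: eventually_mono\<close>)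
    hence "convergent_prod (\<lambda>j. LP_factor N x j z)"
      by (intro abs_convergent_prod_imp_convergent_prod summable_imp_abs_convergent_prod)
    hence "(\<lambda>n. \<Prod>j<Suc n. LP_factor N x j z) \<longlonglongrightarrow> (\<Prod>j. LP_factor N x j z)"
      unfolding lessThan_Suc_atMost by (rule convergent_prod_LIMSEQ)
    hence "(\<lambda>n. \<Prod>j<n. LP_factor N x j z) \<longlonglongrightarrow> (\<Prod>j. LP_factor N x j z)"
      by (rule filterlim_sequentially_Suc[THEN iffD1])
    thus ?thesis
      using tendsto_uniform_limitI[OF g z] LIMSEQ_unique by blast
  qed
  thus ?thesis
    by (intro iffD1[OF uniform_limit_cong' g]) auto
qed

text \<open>The Taylor series of the approximation of \<open>f\<close> with only the first \<open>n\<close> factors.\<close>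
definition LP_partial_fps :: "real \<Rightarrow> real \<Rightarrow> enat \<Rightarrow> (nat \<Rightarrow> real) \<Rightarrow> nat \<Rightarrow> complex fps" where
  "LP_partial_fps c \<sigma> N x n =
     (fps_exp 1 oo (- fps_const (of_real c) * fps_X - fps_const (of_real (\<sigma>\<^sup>2 / 2)) * fps_X ^ 2)) *
     (\<Prod>j<n. (1 - fps_const (of_real (atoms N x j)) * fps_X) *
              (fps_exp 1 oo (fps_const (of_real (atoms N x j)) * fps_X)))"

lemma LP_partial_has_fps_expansion:
  "(\<lambda>z. exp (- of_real c * z - of_real (\<sigma>\<^sup>2 / 2) * z\<^sup>2) * (\<Prod>j<n. LP_factor N x j z))
     has_fps_expansion LP_partial_fps c \<sigma> N x n"
proof -
  have exp: "(\<lambda>z. exp (q z)) has_fps_expansion (fps_exp 1 oo Q)"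
    if "q has_fps_expansion Q" "fps_nth Q 0 = 0" for q :: "complex \<Rightarrow> complex" and Q
    using has_fps_expansion_compose[OF has_fps_expansion_exp[of 1] that] by (simp add: o_def)
  show ?thesis
    unfolding LP_partial_fps_def LP_factor_def weierstrass_factor_1_eq
    by (intro fps_expansion_intros exp) auto
qed

text \<open>The factor \<open>1 - w z\<close> has power sums \<open>w ^ k\<close>, and \<open>exp (w z)\<close> cancels the first of them, so that
  \<open>c\<close> alone remains for \<open>k = 1\<close>.\<close>
lemma LP_partial_fps_nth:
  "fps_nth (LP_partial_fps c \<sigma> N x n) k =
     newton (\<lambda>k. of_real (if k = 1 then c else (if k = 2 then \<sigma>\<^sup>2 else 0) + (\<Sum>j<n. atoms N x j ^ k))) k"
proof -
  let ?Q = "- fps_const (of_real c) * fps_X - fps_const (of_real (\<sigma>\<^sup>2 / 2)) * fps_X ^ 2 :: complex fps"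
  let ?R = "\<lambda>j. fps_const (of_real (atoms N x j)) * fps_X :: complex fps"
  have "has_power_sums (LP_partial_fps c \<sigma> N x n)
    (\<lambda>k. - of_nat k * fps_nth ?Q k +
         (\<Sum>j<n. of_real (atoms N x j) ^ k + (- of_nat k * fps_nth (?R j) k)))"
    unfolding LP_partial_fps_def
    by (intro has_power_sums_mult has_power_sums_prod has_power_sums_linear
              has_power_sums_exp_compose) auto
  moreover have "- of_nat k * fps_nth ?Q k +
         (\<Sum>j<n. of_real (atoms N x j) ^ k + (- of_nat k * fps_nth (?R j) k)) =
       of_real (if k = 1 then c else (if k = 2 then \<sigma>\<^sup>2 else 0) + (\<Sum>j<n. atoms N x j ^ k))"
    if "k \<ge> 1" for k
    using that by (auto simp: fps_X_power_nth fps_X_nth)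
  ultimately have "has_power_sums (LP_partial_fps c \<sigma> N x n)
    (\<lambda>k. of_real (if k = 1 then c else (if k = 2 then \<sigma>\<^sup>2 else 0) + (\<Sum>j<n. atoms N x j ^ k)))"
    by (rule has_power_sums_cong)
  thus ?thesis
    by (rule fps_nth_eq_newton)
qed

text \<open>
  The coefficients of the partial products have two limits that must agree: locally uniform
  convergence of holomorphic functions yields the Taylor coefficients of \<open>f\<close>, and convergence of the
  power sums yields \<open>newton\<close> of the limit power sums.
\<close>
lemma fps_nth_LP_function:
  assumes summ: "(\<lambda>j. 1 / (x j)\<^sup>2) summable_on {j. enat j < N}"
  shows "fps_nth (fps_expansion (LP_function c \<sigma> N x) 0) k = of_real (newton (LP_power_sum c \<sigma> N x) k)"
proof -
  let ?E = "\<lambda>z::complex. exp (- of_real c * z - of_real (\<sigma>\<^sup>2 / 2) * z\<^sup>2)"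
  let ?f = "\<lambda>n z. ?E z * (\<Prod>j<n. LP_factor N x j z)"
  have "uniform_limit (cball 0 1) ?f (LP_function c \<sigma> N x) sequentially"
  proof -
    have 1: "uniform_limit (cball 0 1) (\<lambda>n. ?E) ?E sequentially"
      by (rule uniform_limit_const)
    have bE: "bounded (?E ` cball 0 1)"
      by (intro compact_imp_bounded compact_continuous_image continuous_intros) auto
    have "bounded ((\<lambda>z. \<Prod>j. LP_factor N x j z) ` cball 0 1)"
    proof -
      have "continuous_on (cball 0 1) (\<lambda>z. \<Prod>j. LP_factor N x j z)"
        by (rule uniform_limit_theorem[OF _ uniform_limit_LP_factor_prod[OF summ]])
           (auto simp: LP_factor_def intro!: continuous_intros always_eventually)
      thus ?thesis
        by (intro compact_imp_bounded compact_continuous_image) auto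
    qed
    from uniform_lim_mult[OF 1 uniform_limit_LP_factor_prod[OF summ] bE this]
    show ?thesis
      unfolding LP_function_eq_prodinf[abs_def] .
  qed
  hence "uniform_limit (ball 0 1) ?f (LP_function c \<sigma> N x) sequentially"
    by (rule uniform_limit_on_subset) auto
  hence "(\<lambda>n. (deriv ^^ k) (?f n) 0 / fact k) \<longlonglongrightarrow> (deriv ^^ k) (LP_function c \<sigma> N x) 0 / fact k"
    by (intro tendsto_divide tendsto_const higher_deriv_complex_uniform_limit[where A = "ball 0 1"])
       (auto simp: LP_factor_def intro!: holomorphic_intros always_eventually)
  moreover have "(deriv ^^ k) (?f n) 0 / fact k = fps_nth (LP_partial_fps c \<sigma> N x n) k" for n
    using fps_nth_fps_expansion[OF LP_partial_has_fps_expansion] by metis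
  ultimately have "(\<lambda>n. fps_nth (LP_partial_fps c \<sigma> N x n) k) \<longlonglongrightarrow>
      fps_nth (fps_expansion (LP_function c \<sigma> N x) 0) k"
    by (simp add: fps_expansion_def)
  moreover have "(\<lambda>n. fps_nth (LP_partial_fps c \<sigma> N x n) k) \<longlonglongrightarrow>
      newton (\<lambda>k. of_real (LP_power_sum c \<sigma> N x k)) k"
    unfolding LP_partial_fps_nth
  proof (rule newton_tendsto)
    fix k :: nat assume "k \<ge> 1"
    have "(\<lambda>n. if k = 1 then c else (if k = 2 then \<sigma>\<^sup>2 else 0) + (\<Sum>j<n. atoms N x j ^ k))
             \<longlonglongrightarrow> LP_power_sum c \<sigma> N x k"
    proof (cases "k = 1")
      case False
      with \<open>k \<ge> 1\<close> have "summable (\<lambda>j. atoms N x j ^ k)"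
        by (intro summable_atoms_power summ) auto
      from summable_LIMSEQ[OF this] False show ?thesis
        unfolding LP_power_sum_def by (auto intro!: tendsto_intros)
    qed (simp add: LP_power_sum_def)
    thus "(\<lambda>n. complex_of_real (if k = 1 then c else (if k = 2 then \<sigma>\<^sup>2 else 0) + (\<Sum>j<n. atoms N x j ^ k)))
             \<longlonglongrightarrow> of_real (LP_power_sum c \<sigma> N x k)"
      by (rule tendsto_of_real)
  qed
  ultimately show ?thesis
    using LIMSEQ_unique by (metis newton_of_real)
qed

section \<open>Convergence of the differentiated polynomials\<close>

lemma pochhammer_of_nat_Suc_eq_fact_divide:
  "pochhammer (of_nat (Suc i)) m = (fact (i + m) / fact i :: 'a::field_char_0)"
proof -
  have "(fact (i + m) :: 'a) = fact i * pochhammer (of_nat (Suc i)) m"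
    unfolding pochhammer_fact by (simp add: pochhammer_product' add.commute)
  thus ?thesis by simp
qed

lemma uniform_limit_sum:
  fixes f :: "'i \<Rightarrow> 'b \<Rightarrow> 'a \<Rightarrow> 'c::real_normed_vector"
  assumes "\<And>i. i \<in> I \<Longrightarrow> uniform_limit K (f i) (g i) F"
  shows "uniform_limit K (\<lambda>d z. \<Sum>i\<in>I. f i d z) (\<lambda>z. \<Sum>i\<in>I. g i z) F"
  using assms
  by (induction I rule: infinite_finite_induct) (auto intro!: uniform_limit_intros)

lemma uniform_limit_poly:
  fixes q :: "nat \<Rightarrow> complex poly"
  assumes "compact K"
    and "eventually (\<lambda>d. degree (q d) \<le> l) sequentially" and "degree r \<le> l"
    and "\<And>i. i \<le> l \<Longrightarrow> (\<lambda>d. coeff (q d) i) \<longlonglongrightarrow> coeff r i"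
  shows "uniform_limit K (\<lambda>d z. poly (q d) z) (poly r) sequentially"
proof -
  have poly_eq: "poly s z = (\<Sum>i\<le>l. coeff s i * z ^ i)" if "degree s \<le> l" for s :: "complex poly" and z
    unfolding poly_altdef using that
    by (intro sum.mono_neutral_left) (auto simp: coeff_eq_0)
  have "uniform_limit K (\<lambda>d z. \<Sum>i\<le>l. coeff (q d) i * z ^ i) (\<lambda>z. \<Sum>i\<le>l. coeff r i * z ^ i) sequentially"
  proof (intro uniform_limit_sum uniform_lim_mult)
    fix i assume "i \<in> {..l}"
    thus "uniform_limit K (\<lambda>d z. coeff (q d) i) (\<lambda>z. coeff r i) sequentially"
      using assms(4)[of i] by (simp add: uniform_limit_iff tendsto_iff)
    show "bounded ((\<lambda>z. z ^ i) ` K)"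
      by (intro compact_imp_bounded compact_continuous_image assms continuous_intros)
    show "bounded ((\<lambda>z. coeff r i) ` K)"
      by (auto simp: bounded_iff)
  qed (rule uniform_limit_const)
  also have "?this \<longleftrightarrow> uniform_limit K (\<lambda>d z. poly (q d) z) (poly r) sequentially"
    using assms(2)
    by (intro uniform_limit_cong) (auto elim!: eventually_mono simp: poly_eq assms(3))
  finally show ?thesis .
qed

lemma coeff_fps_D_monom:
  assumes "i \<le> l"
  shows "coeff (fps_D_monom F l) i = fps_nth F (l - i) * (fact l / fact i)"
proof -
  have "coeff (fps_D_monom F l) i =
        (\<Sum>k\<le>l. fps_nth F k * (pochhammer (of_nat (Suc i)) k * (if i + k = l then 1 else 0)))"
    by (simp add: fps_D_monom_def coeff_sum coeff_higher_pderiv eq_commute del: of_nat_Suc)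
  also have "\<dots> = (\<Sum>k\<in>{l - i}. fps_nth F k * (pochhammer (of_nat (Suc i)) k * (if i + k = l then 1 else 0)))"
    using assms by (intro sum.mono_neutral_right) auto
  also have "\<dots> = fps_nth F (l - i) * (fact l / fact i)"
    using assms by (simp add: pochhammer_of_nat_Suc_eq_fact_divide del: of_nat_Suc)
  finally show ?thesis .
qed

text \<open>For fixed \<open>k\<close>, the falling factorial \<open>d (d - 1) \<dots> (d - k + 1)\<close> is asymptotic to \<open>d ^ k\<close>.\<close>
lemma falling_factorial_ratio_tendsto:
  "(\<lambda>d. fact (d - k) * real d ^ k / fact d) \<longlonglongrightarrow> 1"
proof (induction k)
  case (Suc k)
  have "(\<lambda>d. real d / (real d - real k)) \<longlonglongrightarrow> 1"
    by real_asymp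
  from tendsto_mult[OF Suc.IH this]
  have "(\<lambda>d. fact (d - k) * real d ^ k / fact d * (real d / (real d - real k))) \<longlonglongrightarrow> 1"
    by simp
  moreover have "eventually (\<lambda>d. fact (d - k) * real d ^ k / fact d * (real d / (real d - real k)) =
      fact (d - Suc k) * real d ^ Suc k / fact d) sequentially"
    using eventually_gt_at_top[of k]
  proof eventually_elim
    case (elim d)
    hence "fact (d - k) = (real d - real k) * fact (d - Suc k)"
      by (simp add: fact_reduce[of "d - k"] of_nat_diff)
    thus ?case using elim by simp
  qed
  ultimately show ?case
    by (rule Lim_transform_eventually)
qed auto

text \<open>Passing from the roots \<open>y\<close> to \<open>y / d\<close> releases a factor \<open>d ^ k\<close> from the coefficient, which the
  factorials compensate in the limit.\<close>
lemma coeff_tendsto_newton: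
  fixes p :: "nat \<Rightarrow> real poly"
  assumes p: "\<And>d. d \<ge> 1 \<Longrightarrow> real_rooted (p d)" "\<And>d. d \<ge> 1 \<Longrightarrow> lead_coeff (p d) = 1"
      "\<And>d. d \<ge> 1 \<Longrightarrow> degree (p d) = d"
    and lim: "\<And>k. k \<ge> 1 \<Longrightarrow> (\<lambda>d. \<Sum>y\<in>#proots (p d). (y / real d) ^ k) \<longlonglongrightarrow> S k"
  shows "(\<lambda>d. fact (d - k) / fact d * coeff (p d) (d - k)) \<longlonglongrightarrow> newton S k"
proof -
  have "(\<lambda>d. fact (d - k) * real d ^ k / fact d *
            newton (\<lambda>i. \<Sum>y\<in>#proots (p d). (y / real d) ^ i) k) \<longlonglongrightarrow> 1 * newton S k"
    by (intro tendsto_mult falling_factorial_ratio_tendsto newton_tendsto lim)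
  moreover have "eventually (\<lambda>d. fact (d - k) * real d ^ k / fact d *
            newton (\<lambda>i. \<Sum>y\<in>#proots (p d). (y / real d) ^ i) k =
          fact (d - k) / fact d * coeff (p d) (d - k)) sequentially"
    using eventually_ge_at_top[of "max 1 k"]
  proof eventually_elim
    case (elim d)
    have "(\<lambda>i. \<Sum>y\<in>#proots (p d). y ^ i) = (\<lambda>i. real d ^ i * (\<Sum>y\<in>#proots (p d). (y / real d) ^ i))"
      using elim by (simp add: sum_mset_distrib_left power_divide)
    hence "newton (\<lambda>i. \<Sum>y\<in>#proots (p d). y ^ i) k =
             real d ^ k * newton (\<lambda>i. \<Sum>y\<in>#proots (p d). (y / real d) ^ i) k"
      by (simp add: newton_scale)
    moreover have "coeff (p d) (d - k) = newton (\<lambda>i. \<Sum>y\<in>#proots (p d). y ^ i) k"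
      using coeff_real_rooted_eq_newton[of "p d" k] p[of d] elim by simp
    ultimately show ?case by simp
  qed
  ultimately show ?thesis
    by (simp add: Lim_transform_eventually)
qed

theorem theorem2p3:
  fixes c \<sigma> :: real and N :: enat and x :: "nat \<Rightarrow> real" and p :: "nat \<Rightarrow> real poly"
  assumes x_nonzero: "\<And>j. enat j < N \<Longrightarrow> x j \<noteq> 0"
    and x_summable: "(\<lambda>j. 1 / (x j)\<^sup>2) summable_on {j. enat j < N}"
    and p_degree: "\<And>d. d \<ge> 1 \<Longrightarrow> degree (p d) = d"
    and p_monic: "\<And>d. d \<ge> 1 \<Longrightarrow> lead_coeff (p d) = 1"
    and p_real_rooted: "\<And>d. d \<ge> 1 \<Longrightarrow> real_rooted (p d)"
    and moment1: "(\<lambda>d. root_moment 1 (p d)) \<longlonglongrightarrow> c"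
    and moment2: "(\<lambda>d. root_moment 2 (p d)) \<in> \<Theta>(\<lambda>d. real d)"
    and weak: "weakly_converges
        (\<lambda>d. density (root_measure (dilation (1 / real d) (p d))) (\<lambda>t. ennreal (real d * t\<^sup>2)))
        (LP_measure \<sigma> N x)"
  shows "\<forall>l. \<forall>K :: complex set. compact K \<longrightarrow>
    uniform_limit K
      (\<lambda>d z. fact l / fact d * poly ((pderiv ^^ (d - l)) (complexify (p d))) z)
      (\<lambda>z. poly (fps_D_monom (fps_expansion (LP_function c \<sigma> N x) 0) l) z)
      sequentially"
proof (intro allI impI)
  fix l :: nat and K :: "complex set"
  assume K: "compact K"
  let ?F = "fps_expansion (LP_function c \<sigma> N x) 0"
  define q where "q = (\<lambda>d. smult (fact l / fact d) ((pderiv ^^ (d - l)) (complexify (p d))))"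
  have "uniform_limit K (\<lambda>d z. poly (q d) z) (poly (fps_D_monom ?F l)) sequentially"
  proof (rule uniform_limit_poly[OF K])
    show "eventually (\<lambda>d. degree (q d) \<le> l) sequentially"
      using eventually_ge_at_top[of 1]
    proof eventually_elim
      case (elim d)
      thus ?case
        using p_degree[of d] by (simp add: q_def degree_higher_pderiv degree_map_poly)
    qed
    show "degree (fps_D_monom ?F l) \<le> l"
      unfolding fps_D_monom_def
      by (intro degree_sum_le order_trans[OF degree_smult_le])
         (auto simp: degree_higher_pderiv degree_monom_eq)
  next
    fix i assume i: "i \<le> l"
    define k where "k = l - i"
    have "(\<lambda>d. fact (d - k) / fact d * coeff (p d) (d - k)) \<longlonglongrightarrow> newton (LP_power_sum c \<sigma> N x) k"
      by (intro coeff_tendsto_newton p_real_rooted p_monic p_degree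
                scaled_power_sums_tendsto[OF x_summable p_degree p_real_rooted moment1 weak])
    hence "(\<lambda>d. complex_of_real (fact (d - k) / fact d * coeff (p d) (d - k)) * (fact l / fact i))
             \<longlonglongrightarrow> of_real (newton (LP_power_sum c \<sigma> N x) k) * (fact l / fact i)"
      by (intro tendsto_mult tendsto_of_real tendsto_const)
    also have "of_real (newton (LP_power_sum c \<sigma> N x) k) * (fact l / fact i) = coeff (fps_D_monom ?F l) i"
      using i by (simp add: coeff_fps_D_monom fps_nth_LP_function[OF x_summable] k_def)
    finally have lim: "(\<lambda>d. complex_of_real (fact (d - k) / fact d * coeff (p d) (d - k)) * (fact l / fact i))
             \<longlonglongrightarrow> coeff (fps_D_monom ?F l) i" .
    have "eventually (\<lambda>d. complex_of_real (fact (d - k) / fact d * coeff (p d) (d - k)) * (fact l / fact i) =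
            coeff (q d) i) sequentially"
      using eventually_ge_at_top[of l]
    proof eventually_elim
      case (elim d)
      hence "i + (d - l) = d - k" using i by (simp add: k_def)
      thus ?case
        by (simp add: q_def coeff_higher_pderiv pochhammer_of_nat_Suc_eq_fact_divide coeff_map_poly
                 del: of_nat_Suc)
    qed
    thus "(\<lambda>d. coeff (q d) i) \<longlonglongrightarrow> coeff (fps_D_monom ?F l) i"
      by (rule Lim_transform_eventually[OF lim])
  qed
  thus "uniform_limit K
      (\<lambda>d z. fact l / fact d * poly ((pderiv ^^ (d - l)) (complexify (p d))) z)
      (\<lambda>z. poly (fps_D_monom ?F l) z) sequentially"
    by (simp add: q_def)
qed

end
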